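(* For all barriers $B$, $\mathsf{TS}^B\leq_{\mathrm{sW}}\mathsf{RT}^B_2$.
   Context: $\mathbb{N}$ is the set of natural numbers (including $0$). Subsets of $\mathbb{N}$ are identified with their strictly increasing enumerations; $s\sqsubset Y$ means that $s$ is a proper initial segment of $Y$ as a sequence; $\subset$ is strict set inclusion. A set $B$ of finite subsets of $\mathbb{N}$ is a barrier on an infinite set $X\subseteq\mathbb{N}$ if: (1) $\bigcup B=X$; (2) for all $s,t\in B$, $s\not\subset t$; (3) for every infinite $Y\subseteq X$ there is $s\in B$ with $s\sqsubset Y$. The set $X=\bigcup B$ is the base of $B$. For infinite $Y\subseteq X$, $B\vert Y=\{s\in B: s\subseteq Y\}$ (this is a barrier on $Y$, and every barrier $B'\subseteq B$ has this form). $\mathsf{TS}^B$ is the problem whose instances are the functions $f:B\to\mathbb{N}$, where a solution to $f$ is an infinite $Y$ contained in the base of $B$ such that $f(B\vert Y)\neq\mathbb{N}$. For a positive integer $k$, $\mathsf{RT}^B_k$ is the problem whose instances are the functions $g:B\to k=\{0,\dots,k-1\}$, where a solution to $g$ is an infinite subset $H$ of the base of $B$ such that $g$ is constant on $B\vert H$. Instances and solutions are coded as subsets of $\mathbb{N}$ in a standard way, a coloring being given together with its domain (so that the barrier is uniformly computable from a coloring of it). For such problems $\mathsf{P},\mathsf{Q}$, $\mathsf{Q}\leq_{\mathrm{sW}}\mathsf{P}$ (strong Weihrauch reducibility) means: there are Turing functionals $\Phi,\Psi$ such that for every instance $I$ of $\mathsf{Q}$, $\Phi(I)$ is an instance of $\mathsf{P}$,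 and for every solution $\hat Y$ to $\Phi(I)$, $\Psi(\hat Y)$ is a solution to $I$ for $\mathsf{Q}$. *)

theory Defs
  imports Complex_Main "HOL-Library.Infinite_Set" "HOL-Library.Nat_Bijection"
begin

text \<open>
  Turing functionals are given by programs for the functions that are partial recursive
  relative to an oracle \<open>A\<close>, i.e. generated from the initial functions and the characteristic
  function of \<open>A\<close> by composition, primitive recursion and minimisation.
  The programs do not depend on the oracle. They carry no arities: a program that is
  applied to an argument list of the wrong length may simply have no value.
\<close>

datatype prog =
    Zero
  | Succ
  | Proj nat
  | Orac
  | Comp prog "prog list"
  | PrimRec prog prog
  | Mu prog

text \<open>\<open>eval A p xs y\<close>: with oracle \<open>A\<close>, program \<open>p\<close> halts on arguments \<open>xs\<close> with output \<open>y\<close>.\<close>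

inductive eval :: "nat set \<Rightarrow> prog \<Rightarrow> nat list \<Rightarrow> nat \<Rightarrow> bool"
  for A :: "nat set"
where
  zero: "eval A Zero xs 0"
| succ: "eval A Succ [x] (Suc x)"
| proj: "i < length xs \<Longrightarrow> eval A (Proj i) xs (xs ! i)"
| orac: "eval A Orac [x] (if x \<in> A then 1 else 0)"
| comp: "list_all2 (\<lambda>q y. eval A q xs y) qs ys \<Longrightarrow> eval A p ys z
    \<Longrightarrow> eval A (Comp p qs) xs z"
| rec_0: "eval A p xs y \<Longrightarrow> eval A (PrimRec p q) (0 # xs) y"
| rec_Suc: "eval A (PrimRec p q) (n # xs) r \<Longrightarrow> eval A q (n # r # xs) y
    \<Longrightarrow> eval A (PrimRec p q) (Suc n # xs) y"
| mu: "eval A p (n # xs) 0 \<Longrightarrow> (\<And>m. m < n \<Longrightarrow> \<exists>y>0. eval A p (m # xs) y)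
    \<Longrightarrow> eval A (Mu p) xs n"

lemma eval_deterministic: "eval A p xs y \<Longrightarrow> eval A p xs z \<Longrightarrow> y = z"
proof (induction p xs y arbitrary: z rule: eval.induct)
  case (comp xs qs ys p y)
  from comp.prems show ?case
  proof cases
    case c: (comp ys')
    then have "ys = ys'"
      using comp.IH(1) by (auto simp: list_all2_conv_all_nth intro!: nth_equalityI)
    then show ?thesis using c comp.IH by simp
  qed
next
  case (rec_0 p xs y q)
  from rec_0.prems show ?case by cases (auto dest: rec_0.IH)
next
  case (rec_Suc p q n xs r y)
  from rec_Suc.prems show ?case by cases (auto dest!: rec_Suc.IH)
next
  case (mu p n xs)
  from mu.prems show ?case
  proof cases
    case m: mu
    have "\<not> n < z" using mu.IH(1) m(2) by fastforce
    moreover have "\<not> z < n" using mu.IH(2) m(1) by fastforce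
    ultimately show ?thesis by simp
  qed
qed (erule eval.cases; simp)+

text \<open>\<open>computes p A C\<close>: the Turing functional with program \<open>p\<close> is defined at \<open>A\<close>, with value \<open>C\<close>.\<close>

definition computes :: "prog \<Rightarrow> nat set \<Rightarrow> nat set \<Rightarrow> bool" where
  "computes p A C \<longleftrightarrow> (\<forall>n. eval A p [n] (if n \<in> C then 1 else 0))"

lemma computes_unique:
  assumes "computes p A C" and "computes p A D"
  shows "C = D"
proof (rule set_eqI)
  fix n
  have "(if n \<in> C then 1 else 0 :: nat) = (if n \<in> D then 1 else 0)"
    using assms eval_deterministic[of A p "[n]"] unfolding computes_def by metis
  then show "n \<in> C \<longleftrightarrow> n \<in> D" by (simp split: if_splits)
qed

text \<open>Instances and solutions are already coded as sets of natural numbers.\<close>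

record problem =
  instances :: "nat set set"
  solutions :: "nat set \<Rightarrow> nat set set"

definition sW_reducible :: "problem \<Rightarrow> problem \<Rightarrow> bool"  (infix "\<le>\<^sub>s\<^sub>W" 50) where
  "Q \<le>\<^sub>s\<^sub>W P \<longleftrightarrow> (\<exists>\<Phi> \<Psi>. \<forall>I \<in> instances Q. \<exists>J \<in> instances P. computes \<Phi> I J \<and>
     (\<forall>Y \<in> solutions P J. \<exists>Z \<in> solutions Q I. computes \<Psi> Y Z))"

definition initial_segment :: "nat set \<Rightarrow> nat set \<Rightarrow> bool"  (infix "\<sqsubset>" 50) where
  "s \<sqsubset> Y \<longleftrightarrow> finite s \<and> infinite Y \<and> sorted_list_of_set s = map (enumerate Y) [0..<card s]"

definition barrier_on :: "nat set set \<Rightarrow> nat set \<Rightarrow> bool" where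
  "barrier_on B X \<longleftrightarrow> infinite X \<and> (\<forall>s\<in>B. finite s) \<and> \<Union>B = X \<and>
     (\<forall>s\<in>B. \<forall>t\<in>B. \<not> s \<subset> t) \<and>
     (\<forall>Y. infinite Y \<and> Y \<subseteq> X \<longrightarrow> (\<exists>s\<in>B. s \<sqsubset> Y))"

definition barrier :: "nat set set \<Rightarrow> bool" where
  "barrier B \<longleftrightarrow> (\<exists>X. barrier_on B X)"

definition restrict_barrier :: "nat set set \<Rightarrow> nat set \<Rightarrow> nat set set"  (infixl "\<restriction>" 70) where
  "B \<restriction> Y = {s \<in> B. s \<subseteq> Y}"

text \<open>
  A coloring with domain \<open>B\<close> is a function \<open>f :: nat set \<Rightarrow> nat\<close> of which only the values on
  \<open>B\<close> matter. Its code is the join of (the set of codes of) \<open>B\<close> and the graph of \<open>f\<close> on \<open>B\<close>.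
\<close>

definition coloring_code :: "nat set set \<Rightarrow> (nat set \<Rightarrow> nat) \<Rightarrow> nat set" where
  "coloring_code B f =
     sum_encode ` (set_encode ` B <+> (\<lambda>s. prod_encode (set_encode s, f s)) ` B)"

lemma coloring_code_eq_iff:
  assumes "\<forall>s\<in>B. finite s" and "\<forall>s\<in>C. finite s"
  shows "coloring_code B f = coloring_code C g \<longleftrightarrow> B = C \<and> (\<forall>s\<in>B. f s = g s)"
proof
  assume "coloring_code B f = coloring_code C g"
  then have eq: "set_encode ` B <+> (\<lambda>s. prod_encode (set_encode s, f s)) ` B =
      set_encode ` C <+> (\<lambda>s. prod_encode (set_encode s, g s)) ` C"
    unfolding coloring_code_def by (simp add: inj_image_eq_iff inj_sum_encode)
  have parts: "Inl -` (M <+> N) = M" "Inr -` (M <+> N) = N" for M N :: "nat set" by auto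
  have dom: "set_encode ` B = set_encode ` C"
    using arg_cong[OF eq, of "vimage Inl"] unfolding parts .
  have graph: "(\<lambda>s. prod_encode (set_encode s, f s)) ` B
      = (\<lambda>s. prod_encode (set_encode s, g s)) ` C"
    using arg_cong[OF eq, of "vimage Inr"] unfolding parts .
  have "inj_on set_encode (B \<union> C)"
    using assms by (intro inj_onI) (auto simp: set_encode_eq)
  then have "B = C" using dom by (simp add: inj_on_image_eq_iff)
  moreover have "f s = g s" if "s \<in> B" for s
  proof -
    have "prod_encode (set_encode s, f s) \<in> (\<lambda>s. prod_encode (set_encode s, g s)) ` C"
      using graph that by blast
    then obtain t where t: "t \<in> C" "set_encode s = set_encode t" "f s = g t" by auto
    then have "s = t" using set_encode_eq[of s t] assms that by simp
    then show ?thesis using t by simp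
  qed
  ultimately show "B = C \<and> (\<forall>s\<in>B. f s = g s)" by simp
next
  assume "B = C \<and> (\<forall>s\<in>B. f s = g s)"
  then show "coloring_code B f = coloring_code C g"
    by (simp add: coloring_code_def cong: image_cong)
qed

definition TS :: "nat set set \<Rightarrow> problem" where
  "TS B = \<lparr> instances = {coloring_code B f | f. True},
     solutions = (\<lambda>I. {Y. \<exists>f. I = coloring_code B f \<and>
       infinite Y \<and> Y \<subseteq> \<Union>B \<and> f ` (B \<restriction> Y) \<noteq> UNIV}) \<rparr>"

definition RT :: "nat set set \<Rightarrow> nat \<Rightarrow> problem" where
  "RT B k = \<lparr> instances = {coloring_code B g | g. \<forall>s\<in>B. g s < k},
     solutions = (\<lambda>J. {H. \<exists>g. J = coloring_code B g \<and> (\<forall>s\<in>B. g s < k) \<and>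
       infinite H \<and> H \<subseteq> \<Union>B \<and> (\<exists>c. \<forall>s \<in> B \<restriction> H. g s = c)}) \<rparr>"

end

theory Submission
  imports Defs
begin

text \<open>
  Given \<open>f\<close>, let \<open>g s = min (f s) 1\<close>. If \<open>H\<close> is homogeneous for \<open>g\<close> with color \<open>0\<close>, then
  \<open>f\<close> takes at most the value \<open>0\<close> on \<open>B \<restriction> H\<close>; if the color is not \<open>0\<close>, then \<open>f\<close> omits \<open>0\<close> there.
  So \<open>H\<close> itself solves \<open>f\<close>, and it remains to write a program that computes the code of \<open>g\<close>
  from that of \<open>f\<close>.
\<close>

section \<open>Programs for arithmetic, Boolean tests and bounded search\<close>

lemma eval_Proj_0: "eval A (Proj 0) (x # xs) x"
  using eval.proj[of 0 "x # xs"] by simp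

lemma eval_Proj_1: "eval A (Proj 1) (x # y # xs) y"
  using eval.proj[of 1 "x # y # xs"] by simp

lemma eval_Proj_2: "eval A (Proj 2) (x # y # z # xs) z"
  using eval.proj[of 2 "x # y # z # xs"] by simp

lemma eval_Comp_1: "eval A q xs y \<Longrightarrow> eval A p [y] z \<Longrightarrow> eval A (Comp p [q]) xs z"
  by (rule eval.comp[of A xs "[q]" "[y]"]) auto

lemma eval_Comp_2:
  "eval A q xs y \<Longrightarrow> eval A r xs y' \<Longrightarrow> eval A p [y, y'] z \<Longrightarrow> eval A (Comp p [q, r]) xs z"
  by (rule eval.comp[of A xs "[q, r]" "[y, y']"]) auto

definition add_prog :: prog where
  "add_prog = PrimRec (Proj 0) (Comp Succ [Proj 1])"

lemma eval_add_prog: "eval A add_prog [m, n] (m + n)"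
  unfolding add_prog_def
proof (induction m)
  case 0
  then show ?case using eval.rec_0[OF eval_Proj_0] by simp
next
  case (Suc m)
  then show ?case using eval.rec_Suc[OF Suc eval_Comp_1[OF eval_Proj_1 eval.succ]] by simp
qed

definition mult_prog :: prog where
  "mult_prog = PrimRec Zero (Comp add_prog [Proj 2, Proj 1])"

lemma eval_mult_prog: "eval A mult_prog [m, n] (m * n)"
  unfolding mult_prog_def
proof (induction m)
  case 0
  then show ?case using eval.rec_0[OF eval.zero] by simp
next
  case (Suc m)
  then show ?case
    using eval.rec_Suc[OF Suc eval_Comp_2[OF eval_Proj_2 eval_Proj_1 eval_add_prog]] by simp
qed

definition pred_prog :: prog where
  "pred_prog = PrimRec Zero (Proj 0)"

lemma eval_pred_prog: "eval A pred_prog [n] (n - 1)"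
  unfolding pred_prog_def
proof (induction n)
  case 0
  then show ?case using eval.rec_0[OF eval.zero] by simp
next
  case (Suc n)
  then show ?case using eval.rec_Suc[OF Suc eval_Proj_0] by simp
qed

text \<open>The recursion counts applications of the predecessor, so it is the first argument that
  is subtracted from the second.\<close>

definition diff_prog :: prog where
  "diff_prog = PrimRec (Proj 0) (Comp pred_prog [Proj 1])"

lemma eval_diff_prog: "eval A diff_prog [m, n] (n - m)"
  unfolding diff_prog_def
proof (induction m)
  case 0
  then show ?case using eval.rec_0[OF eval_Proj_0] by simp
next
  case (Suc m)
  then show ?case
    using eval.rec_Suc[OF Suc eval_Comp_1[OF eval_Proj_1 eval_pred_prog]] by simp
qed

definition one_prog :: prog where
  "one_prog = Comp Succ [Zero]"

lemma eval_one_prog: "eval A one_prog xs 1"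
  unfolding one_prog_def using eval_Comp_1[OF eval.zero eval.succ] by simp

text \<open>Truncated \<open>1 - y\<close>: nonzero counts as true, and the result is always 0 or
  1.\<close>

definition not_prog :: "prog \<Rightarrow> prog" where
  "not_prog p = Comp diff_prog [p, one_prog]"

lemma eval_not_prog:
  assumes "eval A p xs y"
  shows "eval A (not_prog p) xs (of_bool (y = 0))"
  unfolding not_prog_def
  using eval_Comp_2[OF assms eval_one_prog eval_diff_prog] by (cases y) auto

text \<open>Two numbers agree exactly when both truncated differences vanish, that is, when their
  sum does.\<close>

definition eq_prog :: "prog \<Rightarrow> prog \<Rightarrow> prog" where
  "eq_prog p q = not_prog (Comp add_prog [Comp diff_prog [p, q], Comp diff_prog [q, p]])"

lemma eval_eq_prog:
  assumes "eval A p xs y" and "eval A q xs z"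
  shows "eval A (eq_prog p q) xs (of_bool (y = z))"
proof -
  have "eval A (eq_prog p q) xs (of_bool ((z - y) + (y - z) = 0))"
    unfolding eq_prog_def
    by (rule eval_not_prog eval_Comp_2 eval_add_prog eval_diff_prog assms)+
  moreover have "(z - y) + (y - z) = 0 \<longleftrightarrow> y = z"
    by auto
  ultimately show ?thesis by simp
qed

definition sum_prog :: "prog \<Rightarrow> prog" where
  "sum_prog p = PrimRec Zero (Comp add_prog [Proj 1, Comp p [Proj 0, Proj 2]])"

lemma eval_sum_prog:
  assumes "\<And>x. eval A p [x, n] (F x)"
  shows "eval A (sum_prog p) [m, n] (\<Sum>x<m. F x)"
  unfolding sum_prog_def
proof (induction m)
  case 0
  then show ?case using eval.rec_0[OF eval.zero] by simp
next
  case (Suc m)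
  have "eval A (Comp add_prog [Proj 1, Comp p [Proj 0, Proj 2]]) [m, \<Sum>x<m. F x, n]
      ((\<Sum>x<m. F x) + F m)"
    by (rule eval_Comp_2[OF eval_Proj_1 _ eval_add_prog])
      (rule eval_Comp_2[OF eval_Proj_0 eval_Proj_2 assms])
  then show ?case using eval.rec_Suc[OF Suc] by simp
qed

text \<open>A sum of natural numbers is nonzero iff some summand is; the double negation normalizes
  it to 0 or 1. \<open>Succ\<close> turns the strict bound of the sum into \<open>x \<le> n\<close>,
  and \<open>Proj 0\<close> passes \<open>n\<close> on as the parameter.\<close>

definition ex_le_prog :: "prog \<Rightarrow> prog" where
  "ex_le_prog p = not_prog (not_prog (Comp (sum_prog p) [Succ, Proj 0]))"

lemma eval_ex_le_prog:
  assumes "\<And>x. eval A p [x, n] (F x)"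
  shows "eval A (ex_le_prog p) [n] (of_bool (\<exists>x\<le>n. F x \<noteq> 0))"
proof -
  have "eval A (ex_le_prog p) [n] (of_bool (of_bool ((\<Sum>x<Suc n. F x) = 0) = (0::nat)))"
    unfolding ex_le_prog_def
    by (intro eval_not_prog) (rule eval_Comp_2[OF eval.succ eval_Proj_0 eval_sum_prog[OF assms]])
  moreover have "of_bool ((\<Sum>x<Suc n. F x) = 0) = (0::nat) \<longleftrightarrow> (\<exists>x\<le>n. F x \<noteq> 0)"
    by (auto simp: less_Suc_eq_le simp del: sum.lessThan_Suc)
  ultimately show ?thesis by (simp only:)
qed

section \<open>Codes of colorings and the program that truncates colors\<close>

lemma two_times_prod_encode: "2 * prod_encode (x, v) = (x + v) * Suc (x + v) + 2 * x"
  by (simp add: prod_encode_def triangle_def)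

text \<open>\<open>sum_encode\<close> sends \<open>Inl x\<close> to \<open>2 * x\<close> and
  \<open>Inr y\<close> to \<open>Suc (2 * y)\<close>, so parity separates the domain from the
  graph.\<close>

lemma even_mem_coloring_code: "2 * x \<in> coloring_code B f \<longleftrightarrow> x \<in> set_encode ` B"
  unfolding coloring_code_def Plus_def image_Un image_image sum_encode_def
  by auto presburger

lemma odd_mem_coloring_code:
  "Suc (2 * prod_encode (x, v)) \<in> coloring_code B f \<longleftrightarrow> (\<exists>s\<in>B. x = set_encode s \<and> v = f s)"
  unfolding coloring_code_def Plus_def image_Un image_image sum_encode_def
  by (auto simp: prod_encode_eq) presburger

lemma coloring_code_cases:
  obtains x where "n = 2 * x" | x v where "n = Suc (2 * prod_encode (x, v))"
proof (cases "even n")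
  case True
  then show ?thesis using that(1) by (auto elim: evenE)
next
  case False
  then obtain b where "n = Suc (2 * b)" by (auto elim: oddE)
  then show ?thesis using that(2)[of "fst (prod_decode b)" "snd (prod_decode b)"] by simp
qed

text \<open>The domain is copied, and pairs with value 0 keep their status. A pair with value 1
  enters the new graph when \<open>x\<close> codes a member of \<open>B\<close> whose color is not
  0. The actual color is thus never searched for, and a bounded quantifier suffices.\<close>

lemma mem_coloring_code_min_1:
  fixes f :: "nat set \<Rightarrow> nat"
  assumes "\<forall>s\<in>B. finite s"
  defines "I \<equiv> coloring_code B f"
  shows "n \<in> coloring_code B (\<lambda>s. min (f s) 1) \<longleftrightarrow>
    (\<exists>x\<le>n. n = 2 * x \<and> n \<in> I \<or> n = Suc (2 * prod_encode (x, 0)) \<and> n \<in> I \<or>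
       n = Suc (2 * prod_encode (x, 1)) \<and> 2 * x \<in> I \<and> Suc (2 * prod_encode (x, 0)) \<notin> I)"
    (is "_ \<longleftrightarrow> (\<exists>x\<le>n. ?Q x)")
proof -
  have le: "x \<le> n" if "?Q x" for x
    using that two_times_prod_encode[of x 0] two_times_prod_encode[of x 1] by auto
  \<comment> \<open>No other member of \<open>B\<close> shares the code of \<open>s\<close>, so
    \<open>f s \<noteq> 0\<close> really excludes the pair with value 0.\<close>
  have inj: "s = t" if "s \<in> B" "t \<in> B" "set_encode s = set_encode t" for s t
    using that assms(1) set_encode_eq by blast
  have "n \<in> coloring_code B (\<lambda>s. min (f s) 1) \<longleftrightarrow> (\<exists>x. ?Q x)"
  proof (cases n rule: coloring_code_cases)
    case (1 x)
    have "2 * x \<noteq> Suc (2 * b)" for b by presburger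
    then show ?thesis unfolding 1 I_def by (auto simp: even_mem_coloring_code)
  next
    case (2 x v)
    have min_1: "v = min (f s) 1 \<longleftrightarrow> v = 0 \<and> f s = 0 \<or> v = 1 \<and> f s \<noteq> 0" for s
      by auto
    have "Suc (2 * b) \<noteq> 2 * x" for b x :: nat by presburger
    then have "(\<exists>x. ?Q x) \<longleftrightarrow> v = 0 \<and> n \<in> I \<or>
        v = 1 \<and> 2 * x \<in> I \<and> Suc (2 * prod_encode (x, 0)) \<notin> I"
      unfolding 2 by (auto simp: prod_encode_eq)
    also have "\<dots> \<longleftrightarrow> (\<exists>s\<in>B. x = set_encode s \<and> v = min (f s) 1)"
      unfolding 2 I_def odd_mem_coloring_code even_mem_coloring_code
      using min_1 by (auto dest: inj)
    finally show ?thesis unfolding 2 odd_mem_coloring_code by simp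
  qed
  then show ?thesis using le by blast
qed

text \<open>The factor 2 in the code of a right summand cancels the division by 2 in the pairing
  function, so sums and products suffice. Here \<open>w\<close> computes \<open>x + v\<close> by
  \<open>v\<close> successors.\<close>

definition odd_code_prog :: "nat \<Rightarrow> prog" where
  "odd_code_prog v =
     (let w = ((\<lambda>p. Comp Succ [p]) ^^ v) (Proj 0) in
      Comp Succ [Comp add_prog [Comp mult_prog [w, Comp Succ [w]], Comp add_prog [Proj 0, Proj 0]]])"

lemma eval_odd_code_prog:
  "eval A (odd_code_prog v) (x # xs) (Suc (2 * prod_encode (x, v)))"
proof -
  have w: "eval A (((\<lambda>p. Comp Succ [p]) ^^ v) (Proj 0)) (x # xs) (x + v)"
    by (induction v) (auto intro: eval_Proj_0 eval_Comp_1 eval.succ)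
  have "eval A (odd_code_prog v) (x # xs) (Suc ((x + v) * Suc (x + v) + (x + x)))"
    unfolding odd_code_prog_def Let_def
    by (intro eval_Comp_1[OF _ eval.succ] eval_Comp_2[OF _ _ eval_add_prog]
        eval_Comp_2[OF _ _ eval_mult_prog] eval_Proj_0 w)
  then show ?thesis unfolding two_times_prod_encode by (simp add: mult_2)
qed

text \<open>This transcribes the condition of \<open>mem_coloring_code_min_1\<close>: sums act as
  disjunctions, products as conjunctions. Argument 0 is the search variable \<open>x\<close>,
  argument 1 the number \<open>n\<close> to be decided.\<close>

definition min_1_prog :: prog where
  "min_1_prog = ex_le_prog (Comp add_prog
     [Comp mult_prog
        [Comp add_prog [eq_prog (Proj 1) (Comp add_prog [Proj 0, Proj 0]),
                        eq_prog (Proj 1) (odd_code_prog 0)],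
         Comp Orac [Proj 1]],
      Comp mult_prog
        [eq_prog (Proj 1) (odd_code_prog 1),
         Comp mult_prog
           [Comp Orac [Comp add_prog [Proj 0, Proj 0]],
            not_prog (Comp Orac [odd_code_prog 0])]]])"

lemma computes_min_1_prog:
  assumes "\<forall>s\<in>B. finite s"
  shows "computes min_1_prog (coloring_code B f) (coloring_code B (\<lambda>s. min (f s) 1))"
  unfolding computes_def
proof
  fix n
  let ?I = "coloring_code B f"
  let ?\<chi> = "\<lambda>x. if x \<in> ?I then 1 else 0 :: nat"
  \<comment> \<open>The shape follows the program, with \<open>x + x\<close> for doubling, so that
    the evaluation rules produce exactly this value.\<close>
  let ?F = "\<lambda>x. (of_bool (n = x + x) + of_bool (n = Suc (2 * prod_encode (x, 0)))) * ?\<chi> n +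
    of_bool (n = Suc (2 * prod_encode (x, 1))) *
      (?\<chi> (x + x) * of_bool (?\<chi> (Suc (2 * prod_encode (x, 0))) = 0))"
  have "eval ?I min_1_prog [n] (of_bool (\<exists>x\<le>n. ?F x \<noteq> 0))"
    unfolding min_1_prog_def
    by (intro eval_ex_le_prog eval_Comp_2[OF _ _ eval_add_prog] eval_Comp_2[OF _ _ eval_mult_prog]
        eval_eq_prog eval_not_prog eval_Comp_1[OF _ eval.orac] eval_odd_code_prog
        eval_Proj_0 eval_Proj_1)
  moreover have "(\<exists>x\<le>n. ?F x \<noteq> 0) \<longleftrightarrow> n \<in> coloring_code B (\<lambda>s. min (f s) 1)"
    unfolding mem_coloring_code_min_1[OF assms]
    by (intro ex_cong1 conj_cong refl) (auto simp: mult_2)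
  ultimately show "eval ?I min_1_prog [n] (if n \<in> coloring_code B (\<lambda>s. min (f s) 1) then 1 else 0)"
    by (simp add: of_bool_def)
qed

section \<open>The reduction\<close>

lemma computes_Orac: "computes Orac A A"
  unfolding computes_def using eval.orac by simp

text \<open>A surjective \<open>f\<close> attains both 0 and 1, which truncation at 1 keeps
  distinct.\<close>

lemma homogeneous_min_1_imp_thin:
  fixes f :: "'a \<Rightarrow> nat"
  assumes "\<forall>s\<in>S. min (f s) 1 = c"
  shows "f ` S \<noteq> UNIV"
proof
  assume surj: "f ` S = UNIV"
  obtain s t where "s \<in> S" "f s = 0" "t \<in> S" "f t = 1"
    using surj by (metis UNIV_I imageE)
  then have "c = min (f s) 1" "c = min (f t) 1"
    using assms by auto
  then show False using \<open>f s = 0\<close> \<open>f t = 1\<close> by simp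
qed

theorem proposition7:
  fixes B :: "nat set set"
  assumes "barrier B"
  shows "TS B \<le>\<^sub>s\<^sub>W RT B 2"
proof -
  have fin: "\<forall>s\<in>B. finite s"
    using assms by (auto simp: barrier_def barrier_on_def)
  \<comment> \<open>Both programs are fixed before \<open>I\<close>. The backward one is
    \<open>Orac\<close>, since a homogeneous set is itself the solution.\<close>
  have "\<exists>J\<in>instances (RT B 2). computes min_1_prog I J \<and>
      (\<forall>Y\<in>solutions (RT B 2) J. \<exists>Z\<in>solutions (TS B) I. computes Orac Y Z)"
    if inst: "I \<in> instances (TS B)" for I
  proof -
    obtain f where I: "I = coloring_code B f"
      using inst by (auto simp: TS_def)
    let ?g = "\<lambda>s. min (f s) 1"
    have "Y \<in> solutions (TS B) I" if Y: "Y \<in> solutions (RT B 2) (coloring_code B ?g)" for Y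
    proof -
      obtain g c where "coloring_code B ?g = coloring_code B g" "infinite Y" "Y \<subseteq> \<Union>B"
        and "\<forall>s\<in>B \<restriction> Y. g s = c"
        using Y by (auto simp: RT_def)
      \<comment> \<open>The solution only supplies some coloring \<open>g\<close> with the same
        code; equal codes force \<open>g\<close> and \<open>?g\<close> to agree on
        \<open>B\<close>.\<close>
      moreover from this have "\<forall>s\<in>B \<restriction> Y. ?g s = c"
        using coloring_code_eq_iff[OF fin fin, of ?g g] by (auto simp: restrict_barrier_def)
      ultimately show ?thesis
        using homogeneous_min_1_imp_thin[of "B \<restriction> Y" f c] I by (auto simp: TS_def)
    qed
    moreover have "coloring_code B ?g \<in> instances (RT B 2)"
      by (auto simp: RT_def intro!: exI[of _ ?g])
    ultimately show ?thesis
      using computes_min_1_prog[OF fin] computes_Orac I by blast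
  qed
  then show ?thesis unfolding sW_reducible_def by blast
qed

end
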